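(* For integers $d\geq 1$, define $\alpha_d(n)$ recursively by $\alpha_1(n):=1$ and $\alpha_d(n):=\frac12+\sqrt{2n\,\alpha_{d-1}(n)+\frac14}$ for $d\geq 2$. For all integers $n\geq d\geq 1$, if a family $\mathcal{F}\subseteq 2^{[n]}$ satisfies $h_n(\mathcal{F})>\alpha_d(n)$, then $\mathcal{F}$ contains a $d$-dimensional Boolean algebra.
   Context: Let $[n]=\{1,2,\ldots,n\}$ and let $2^{[n]}$ denote the power set of $[n]$. A collection $\mathcal{B}\subseteq 2^{[n]}$ forms a $d$-dimensional Boolean algebra if there exist pairwise disjoint sets $X_0,X_1,\ldots,X_d\subseteq[n]$, all non-empty with perhaps the exception of $X_0$, such that $\mathcal{B}=\{X_0\cup\bigcup_{i\in I}X_i : I\subseteq[d]\}$. A family $\mathcal{F}$ contains a $d$-dimensional Boolean algebra if some subcollection of $\mathcal{F}$ is a $d$-dimensional Boolean algebra. The Lubell function of a family $\mathcal{F}\subseteq 2^{[n]}$ is $h_n(\mathcal{F}):=\sum_{F\in\mathcal{F}}\frac{1}{\binom{n}{|F|}}$. *)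

theory Defs
  imports Complex_Main "HOL-Library.Disjoint_Sets"
begin

definition boolean_algebra_dim :: "nat \<Rightarrow> nat \<Rightarrow> nat set set \<Rightarrow> bool" where
  "boolean_algebra_dim n d B \<longleftrightarrow>
     (\<exists>X :: nat \<Rightarrow> nat set.
        (\<forall>i\<in>{0..d}. X i \<subseteq> {1..n}) \<and>
        disjoint_family_on X {0..d} \<and>
        (\<forall>i\<in>{1..d}. X i \<noteq> {}) \<and>
        B = {X 0 \<union> (\<Union>i\<in>I. X i) | I. I \<subseteq> {1..d}})"

definition contains_boolean_algebra :: "nat \<Rightarrow> nat \<Rightarrow> nat set set \<Rightarrow> bool" where
  "contains_boolean_algebra n d F \<longleftrightarrow> (\<exists>B \<subseteq> F. boolean_algebra_dim n d B)"

definition lubell :: "nat \<Rightarrow> nat set set \<Rightarrow> real" where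
  "lubell n F = (\<Sum>A\<in>F. 1 / real (n choose card A))"

text \<open>The recursion starts at \<open>d = 1\<close>; the value at \<open>d = 0\<close> is a convention only.\<close>

fun alpha :: "nat \<Rightarrow> nat \<Rightarrow> real" where
  "alpha 0 n = 0"
| "alpha (Suc 0) n = 1"
| "alpha (Suc (Suc d)) n = 1/2 + sqrt (2 * real n * alpha (Suc d) n + 1/4)"

end

theory Submission
  imports Defs "HOL-Analysis.Convex"
begin

text \<open>
  Count pairs \<open>A \<subset> B\<close> in the family along a uniformly random maximal chain of the cube on
  \<open>n\<close> points. The number \<open>Y\<close> of members of \<open>F\<close> on the chain has mean \<open>h = h\<^sub>n(F)\<close>, so
  by convexity the expected number of pairs, \<open>E (Y choose 2)\<close>, is at least \<open>h (h - 1) / 2\<close>. A pair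
  \<open>A \<subset> B\<close> is determined by \<open>A\<close> and the nonempty difference \<open>S = B - A\<close>, and it lies on the chain
  with probability \<open>1 / ((n choose |S|) * (n - |S| choose |A|))\<close>. So, if \<open>F\<^sub>S\<close> denotes the
  family of all \<open>A\<close> disjoint from \<open>S\<close> with \<open>A\<close> and \<open>A \<union> S\<close> both in \<open>F\<close>, the expected number of
  pairs is the sum over \<open>S\<close> of the Lubell value of \<open>F\<^sub>S\<close> on the complement of \<open>S\<close>, with weights
  \<open>1 / (n choose |S|)\<close> that add up to \<open>n\<close>. The recursion for \<open>\<alpha>\<close> is the relation
  \<open>\<alpha>\<^sub>d (\<alpha>\<^sub>d - 1) / 2 = n * \<alpha>\<^bsub>d-1\<^esub>\<close>. Hence \<open>h > \<alpha>\<^sub>d\<close> forces some \<open>F\<^sub>S\<close> to have Lubell value above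
  \<open>\<alpha>\<^bsub>d-1\<^esub>\<close>; by induction \<open>F\<^sub>S\<close> contains a cube of dimension \<open>d - 1\<close>, and \<open>S\<close> is the new
  direction.

  Three lemmas carry this: \<open>chain_sum_square_le\<close> (convexity), \<open>chain_sum_pairs\<close> (regrouping by
  \<open>S\<close>) and \<open>ex_cube_if_chain_sum_gt_alpha\<close> (the induction). Since the value \<open>0\<close> chosen for \<open>\<alpha>\<^sub>0\<close>
  turns \<open>\<alpha>\<^sub>1 = 1\<close> into an instance of the recursion, the induction can start at dimension \<open>0\<close>, where it only says that a family
  with positive Lubell value is nonempty.
\<close>

section \<open>Sums along a random maximal chain\<close>

text \<open>
  A random maximal chain in the cube on \<open>V\<close> passes through \<open>B \<subseteq> V\<close> with probability
  \<open>1 / (|V| choose |B|)\<close>, so this is the expected total of \<open>g\<close> over the members of \<open>F\<close> on that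
  chain. The family is not confined to the subsets of \<open>V\<close>, which lets \<open>V\<close> shrink while
  \<open>F\<close> stays the same.
\<close>

definition chain_sum :: "'a set set \<Rightarrow> ('a set \<Rightarrow> real) \<Rightarrow> 'a set \<Rightarrow> real" where
  "chain_sum F g V = (\<Sum>B\<in>F \<inter> Pow V. g B / real (card V choose card B))"

text \<open>
  Choosing the last but one set \<open>V - {x}\<close> of the chain first expresses the expectation as an average
  over the point \<open>x\<close>; the set \<open>V\<close> itself, which is on every chain, is the only one missed.
\<close>

lemma chain_sum_average:
  assumes fin: "finite V" and "V \<noteq> {}" and "V \<notin> F"
  shows "chain_sum F g V = (\<Sum>x\<in>V. chain_sum F g (V - {x})) / real (card V)"
proof -
  have "(\<Sum>x\<in>V. chain_sum F g (V - {x}))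
      = (\<Sum>x\<in>V. \<Sum>B | B \<in> F \<inter> Pow V \<and> x \<notin> B. g B / real (card V - 1 choose card B))"
    using fin by (auto simp: chain_sum_def intro!: sum.cong)
  also have "\<dots> = (\<Sum>B\<in>F \<inter> Pow V. \<Sum>x | x \<in> V \<and> x \<notin> B. g B / real (card V - 1 choose card B))"
    by (rule sum.swap_restrict) (use fin in auto)
  also have "\<dots> = (\<Sum>B\<in>F \<inter> Pow V. real (card V) * (g B / real (card V choose card B)))"
  proof (rule sum.cong[OF refl])
    fix B assume B: "B \<in> F \<inter> Pow V"
    then have lt: "card B < card V"
      using fin \<open>V \<notin> F\<close> by (intro psubset_card_mono) auto
    have "{x. x \<in> V \<and> x \<notin> B} = V - B" by auto
    then have card: "card {x. x \<in> V \<and> x \<notin> B} = card V - card B"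
      using B fin by (metis IntD2 PowD card_Diff_subset finite_subset)
    have "(card V - card B) * (card V choose card B) = card V * (card V - 1 choose card B)"
      by (rule binomial_absorb_comp)
    then have "real (card V - card B) * real (card V choose card B)
        = real (card V) * real (card V - 1 choose card B)"
      by (metis of_nat_mult)
    moreover have "card V choose card B > 0" "card V - 1 choose card B > 0"
      using lt by auto
    ultimately show "(\<Sum>x | x \<in> V \<and> x \<notin> B. g B / real (card V - 1 choose card B))
        = real (card V) * (g B / real (card V choose card B))"
      by (simp add: card field_simps)
  qed
  also have "\<dots> = real (card V) * chain_sum F g V"
    by (simp only: chain_sum_def sum_distrib_left)
  finally show ?thesis
    using fin \<open>V \<noteq> {}\<close> by simp
qed

lemma chain_sum_remove_top:
  assumes "finite V" and "V \<in> F"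
  shows "chain_sum F g V = g V + chain_sum (F - {V}) g V"
proof -
  have "F \<inter> Pow V = insert V ((F - {V}) \<inter> Pow V)" using assms by auto
  then show ?thesis
    using assms by (simp add: chain_sum_def)
qed

text \<open>
  Second moment against squared mean. If \<open>Y\<close> is the number of members of \<open>F\<close> on the chain, then
  \<open>Y\<^sup>2\<close> is the sum, over these members \<open>B\<close>, of \<open>2 m - 1\<close> where \<open>m\<close> is the number of
  members up to and including \<open>B\<close>; conditioned on the chain passing through \<open>B\<close>, the mean of \<open>m\<close> is
  the chain sum on \<open>B\<close>. So the right-hand side is \<open>E Y\<^sup>2\<close>. Induction on \<open>V\<close> avoids the chains
  themselves: removing \<open>V\<close> from \<open>F\<close> changes both sides explicitly, and once \<open>V\<close> is not in
  \<open>F\<close> both sides are averages over smaller ground sets.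
\<close>

lemma chain_sum_square_le:
  assumes "finite V"
  shows "(chain_sum F (\<lambda>_. 1) V)\<^sup>2 \<le> chain_sum F (\<lambda>B. 2 * chain_sum F (\<lambda>_. 1) B - 1) V"
  using assms
proof (induction V rule: finite_psubset_induct)
  case (psubset V)
  let ?L = "chain_sum F (\<lambda>_. 1)"
  let ?g = "\<lambda>B. 2 * ?L B - 1"
  let ?G = "F - {V}"
  let ?L' = "chain_sum ?G (\<lambda>_. 1) V"
  have main: "?L'\<^sup>2 \<le> chain_sum ?G ?g V"
  proof (cases "V = {}")
    case True
    then have "?G \<inter> Pow V = {}" by auto
    then show ?thesis by (simp add: chain_sum_def)
  next
    case False
    let ?n = "real (card V)"
    have n: "?n > 0" using False psubset.hyps by (simp add: card_gt_0_iff)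
    have same: "chain_sum ?G f (V - {x}) = chain_sum F f (V - {x})" if "x \<in> V" for f x
    proof -
      have "?G \<inter> Pow (V - {x}) = F \<inter> Pow (V - {x})" using that by auto
      then show ?thesis by (simp add: chain_sum_def)
    qed
    have avg: "chain_sum ?G f V = (\<Sum>x\<in>V. chain_sum F f (V - {x})) / ?n" for f
      using chain_sum_average[OF psubset.hyps False, of ?G f] same by simp
    have "(\<Sum>x\<in>V. ?L (V - {x}))\<^sup>2 \<le> (\<Sum>x\<in>V. (?L (V - {x}))\<^sup>2) * ?n"
      by (rule sum_squared_le_sum_of_squares)
    also have "\<dots> \<le> (\<Sum>x\<in>V. chain_sum F ?g (V - {x})) * ?n"
      by (auto intro!: mult_right_mono sum_mono psubset.IH)
    finally have "(\<Sum>x\<in>V. ?L (V - {x}))\<^sup>2 \<le> (\<Sum>x\<in>V. chain_sum F ?g (V - {x})) * ?n" .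
    then show ?thesis
      using n by (simp add: avg power_divide divide_le_eq power2_eq_square)
  qed
  show ?case
  proof (cases "V \<in> F")
    case True
    have L: "?L V = 1 + ?L'"
      using chain_sum_remove_top[OF psubset.hyps True] by simp
    then have "chain_sum F ?g V = 1 + 2 * ?L' + chain_sum ?G ?g V"
      using chain_sum_remove_top[OF psubset.hyps True, of ?g] by simp
    then show ?thesis using main L by (simp add: power2_eq_square algebra_simps)
  next
    case False
    then show ?thesis using main by simp
  qed
qed

section \<open>Grouping comparable pairs by their difference\<close>

text \<open>The family \<open>F\<^sub>S\<close> of lower ends of pairs with difference \<open>S\<close>.\<close>

definition difference_family :: "'a set set \<Rightarrow> 'a set \<Rightarrow> 'a set set" where
  "difference_family F S = {A \<in> F. A \<inter> S = {} \<and> A \<union> S \<in> F}"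

text \<open>Both sides are the multinomial coefficient for blocks of sizes \<open>a\<close>, \<open>s\<close> and \<open>n - a - s\<close>.\<close>

lemma choose_mult_choose_swap:
  assumes "a + s \<le> n"
  shows "(n choose (a + s)) * (a + s choose a) = (n choose s) * (n - s choose a)"
proof -
  have "(n choose (a + s)) * (a + s choose s) = (n choose s) * (n - s choose (a + s - s))"
    using assms by (intro choose_mult) auto
  moreover have "a + s choose s = a + s choose a"
    using binomial_symmetric[of s "a + s"] by simp
  ultimately show ?thesis by simp
qed

text \<open>
  Two ways of computing the expected number of comparable pairs on the chain: first the larger set
  \<open>B\<close> and then the smaller one inside it, or first the difference \<open>S\<close> and then the smaller set in
  the complement of \<open>S\<close>.
\<close>

lemma chain_sum_pairs:
  assumes fin: "finite V"
  shows "chain_sum F (\<lambda>B. chain_sum (F - {B}) (\<lambda>_. 1) B) V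
       = (\<Sum>S\<in>Pow V - {{}}. chain_sum (difference_family F S) (\<lambda>_. 1) (V - S)
            / real (card V choose card S))"
proof -
  let ?n = "card V"
  have finB: "finite B" if "B \<subseteq> V" for B using that fin finite_subset by blast
  define P where "P = (SIGMA B:F \<inter> Pow V. (F - {B}) \<inter> Pow B)"
  define Q where "Q = (SIGMA S:Pow V - {{}}. difference_family F S \<inter> Pow (V - S))"
  have "chain_sum F (\<lambda>B. chain_sum (F - {B}) (\<lambda>_. 1) B) V
      = (\<Sum>(B, A)\<in>P. 1 / (real (?n choose card B) * real (card B choose card A)))"
    unfolding P_def chain_sum_def
    by (subst sum.Sigma[symmetric])
      (auto simp: fin finB sum_divide_distrib mult.commute)
  also have "\<dots> = (\<Sum>(S, A)\<in>Q. 1 / (real (?n choose card S) * real (?n - card S choose card A)))"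
  proof (rule sum.reindex_bij_witness[where i = "\<lambda>(S, A). (A \<union> S, A)" and j = "\<lambda>(B, A). (B - A, A)"])
    fix p assume "p \<in> P"
    then obtain A B where p: "p = (B, A)" and AB: "A \<in> F" "B \<in> F" "B \<subseteq> V" "A \<subset> B"
      by (auto simp: P_def)
    have un: "A \<union> B = B" using AB by auto
    show "(case (case p of (B, A) \<Rightarrow> (B - A, A)) of (S, A) \<Rightarrow> (A \<union> S, A)) = p"
      using p AB by auto
    show "(case p of (B, A) \<Rightarrow> (B - A, A)) \<in> Q"
      using p AB un by (auto simp: Q_def difference_family_def)
    have le: "card A \<le> card B" using AB finB by (intro card_mono) auto
    have cS: "card (B - A) = card B - card A"
      using AB finB by (intro card_Diff_subset) (auto intro: finite_subset)
    have "card B \<le> ?n" using AB fin by (intro card_mono) auto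
    then have "(?n choose card B) * (card B choose card A)
        = (?n choose card (B - A)) * (?n - card (B - A) choose card A)"
      using choose_mult_choose_swap[of "card A" "card (B - A)" ?n] le cS by simp
    then have "real (?n choose card B) * real (card B choose card A)
        = real (?n choose card (B - A)) * real (?n - card (B - A) choose card A)"
      by (metis of_nat_mult)
    then show "(case (case p of (B, A) \<Rightarrow> (B - A, A)) of (S, A) \<Rightarrow>
            1 / (real (?n choose card S) * real (?n - card S choose card A)))
        = (case p of (B, A) \<Rightarrow> 1 / (real (?n choose card B) * real (card B choose card A)))"
      by (simp add: p)
  next
    fix q assume "q \<in> Q"
    then show "(case (case q of (S, A) \<Rightarrow> (A \<union> S, A)) of (B, A) \<Rightarrow> (B - A, A)) = q"
      and "(case q of (S, A) \<Rightarrow> (A \<union> S, A)) \<in> P"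
      by (auto simp: P_def Q_def difference_family_def)
  qed
  also have "\<dots> = (\<Sum>S\<in>Pow V - {{}}. \<Sum>A\<in>difference_family F S \<inter> Pow (V - S).
      1 / (real (?n choose card S) * real (?n - card S choose card A)))"
    unfolding Q_def by (rule sum.Sigma[symmetric]) (auto simp: fin)
  also have "\<dots> = (\<Sum>S\<in>Pow V - {{}}. chain_sum (difference_family F S) (\<lambda>_. 1) (V - S)
            / real (?n choose card S))"
    by (rule sum.cong)
      (auto simp: chain_sum_def sum_divide_distrib card_Diff_subset finB mult.commute)
  finally show ?thesis .
qed

text \<open>Each of the \<open>n\<close> nonzero cardinalities contributes \<open>1\<close>.\<close>

lemma sum_inverse_choose_nonempty_subsets:
  assumes fin: "finite V"
  shows "(\<Sum>S\<in>Pow V - {{}}. 1 / real (card V choose card S)) = real (card V)"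
proof -
  have level: "(\<Sum>S | S \<in> Pow V - {{}} \<and> card S = k. 1 / real (card V choose card S)) = 1"
    if k: "k \<in> {1..card V}" for k
  proof -
    have "{S. S \<in> Pow V - {{}} \<and> card S = k} = {S. S \<subseteq> V \<and> card S = k}" using k by auto
    then show ?thesis using n_subsets[OF fin, of k] k by simp
  qed
  have img: "card ` (Pow V - {{}}) \<subseteq> {1..card V}"
    using fin by (auto simp: card_mono Suc_le_eq card_gt_0_iff dest: finite_subset)
  have "(\<Sum>S\<in>Pow V - {{}}. 1 / real (card V choose card S))
      = (\<Sum>k\<in>{1..card V}. \<Sum>S | S \<in> Pow V - {{}} \<and> card S = k. 1 / real (card V choose card S))"
    by (rule sum.group[symmetric]) (use fin img in auto)
  also have "\<dots> = (\<Sum>k\<in>{1..card V}. 1)" by (rule sum.cong[OF refl level])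
  finally show ?thesis by simp
qed

section \<open>The threshold recursion\<close>

lemma alpha_Suc: "alpha (Suc d) n = 1/2 + sqrt (2 * real n * alpha d n + 1/4)"
  by (cases d) (simp_all add: real_sqrt_divide)

lemma alpha_nonneg: "0 \<le> alpha d n"
  by (induction d) (auto simp: alpha_Suc simp del: alpha.simps(2,3))

lemma alpha_mono: "m \<le> n \<Longrightarrow> alpha d m \<le> alpha d n"
proof (induction d)
  case (Suc d)
  then have "real m * alpha d m \<le> real n * alpha d n"
    by (intro mult_mono) (auto simp: alpha_nonneg)
  then show ?case by (simp add: alpha_Suc del: alpha.simps(2,3))
qed simp

lemma alpha_Suc_less_imp:
  assumes "alpha (Suc d) n < h"
  shows "2 * real n * alpha d n < h\<^sup>2 - h"
proof -
  let ?r = "2 * real n * alpha d n + 1/4"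
  have "0 \<le> ?r" by (simp add: alpha_nonneg)
  moreover have "sqrt ?r < h - 1/2" using assms by (simp add: alpha_Suc del: alpha.simps(2,3))
  ultimately have "?r < (h - 1/2)\<^sup>2"
    by (metis real_sqrt_ge_zero real_sqrt_pow2 power_strict_mono pos2)
  then show ?thesis by (simp add: power2_eq_square algebra_simps)
qed

section \<open>Finding the cube\<close>

text \<open>
  Averaging over \<open>S\<close>: if every \<open>F\<^sub>S\<close> had Lubell value at most \<open>\<alpha>\<^sub>d\<close>, the expected number of pairs
  would be at most \<open>n * \<alpha>\<^sub>d\<close>, whereas the second moment bound gives more.
\<close>

lemma ex_difference_family_gt_alpha:
  assumes fin: "finite V" and gt: "alpha (Suc d) (card V) < chain_sum F (\<lambda>_. 1) V"
  obtains S where "S \<subseteq> V" "S \<noteq> {}"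
    "alpha d (card (V - S)) < chain_sum (difference_family F S) (\<lambda>_. 1) (V - S)"
proof (rule ccontr)
  assume "\<not> thesis"
  with that have none: "\<forall>S. S \<subseteq> V \<longrightarrow> S \<noteq> {} \<longrightarrow>
      \<not> alpha d (card (V - S)) < chain_sum (difference_family F S) (\<lambda>_. 1) (V - S)"
    by blast
  let ?n = "card V"
  let ?L = "chain_sum F (\<lambda>_. 1)"
  let ?p = "\<lambda>B. chain_sum (F - {B}) (\<lambda>_. 1) B"
  have bound: "chain_sum (difference_family F S) (\<lambda>_. 1) (V - S) \<le> alpha d ?n"
    if S: "S \<in> Pow V - {{}}" for S
  proof -
    have "chain_sum (difference_family F S) (\<lambda>_. 1) (V - S) \<le> alpha d (card (V - S))"
      using none S by (auto simp: not_less)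
    also have "\<dots> \<le> alpha d ?n" using fin by (intro alpha_mono card_mono) auto
    finally show ?thesis .
  qed
  have "chain_sum F ?p V \<le> (\<Sum>S\<in>Pow V - {{}}. alpha d ?n * (1 / real (?n choose card S)))"
    unfolding chain_sum_pairs[OF fin]
    by (intro sum_mono)
      (simp only: times_divide_eq_right mult_1_right, intro divide_right_mono bound of_nat_0_le_iff)
  also have "\<dots> = alpha d ?n * real ?n"
    by (simp only: sum_inverse_choose_nonempty_subsets[OF fin] flip: sum_distrib_left)
  finally have upper: "chain_sum F ?p V \<le> real ?n * alpha d ?n" by (simp add: mult.commute)
  have "?L B = 1 + ?p B" if "B \<in> F \<inter> Pow V" for B
    using that fin by (intro chain_sum_remove_top) (auto intro: finite_subset)
  then have "chain_sum F (\<lambda>B. 2 * ?L B - 1) V = chain_sum F (\<lambda>B. 1 + 2 * ?p B) V"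
    unfolding chain_sum_def[of F _ V] by (intro sum.cong) auto
  also have "\<dots> = ?L V + 2 * chain_sum F ?p V"
    by (simp add: chain_sum_def[of F _ V] add_divide_distrib sum.distrib sum_distrib_left)
  finally have "(?L V)\<^sup>2 - ?L V \<le> 2 * chain_sum F ?p V"
    using chain_sum_square_le[OF fin, of F] by simp
  then show False using upper alpha_Suc_less_imp[OF gt] by simp
qed

lemma ex_cube_if_chain_sum_gt_alpha:
  assumes "finite V" and "alpha d (card V) < chain_sum F (\<lambda>_. 1) V"
  shows "\<exists>X :: nat \<Rightarrow> 'a set. (\<forall>i\<le>d. X i \<subseteq> V) \<and> disjoint_family_on X {..d} \<and>
    (\<forall>i\<in>{1..d}. X i \<noteq> {}) \<and> (\<forall>I\<subseteq>{1..d}. X 0 \<union> (\<Union>i\<in>I. X i) \<in> F)"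
  using assms
proof (induction d arbitrary: V F)
  case 0
  have "F \<inter> Pow V \<noteq> {}"
  proof
    assume "F \<inter> Pow V = {}"
    then show False using 0 by (simp add: chain_sum_def)
  qed
  then obtain A where "A \<in> F" "A \<subseteq> V" by auto
  then show ?case by (intro exI[of _ "\<lambda>_. A"]) (auto simp: disjoint_family_on_def)
next
  case (Suc d)
  obtain S where S: "S \<subseteq> V" "S \<noteq> {}"
    and gt: "alpha d (card (V - S)) < chain_sum (difference_family F S) (\<lambda>_. 1) (V - S)"
    using ex_difference_family_gt_alpha[OF Suc.prems] .
  obtain X where sub: "\<And>i. i \<le> d \<Longrightarrow> X i \<subseteq> V - S" and disj: "disjoint_family_on X {..d}"
    and ne: "\<And>i. i \<in> {1..d} \<Longrightarrow> X i \<noteq> {}"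
    and mem: "\<And>I. I \<subseteq> {1..d} \<Longrightarrow> X 0 \<union> (\<Union>i\<in>I. X i) \<in> difference_family F S"
    using Suc.IH[OF _ gt] Suc.prems(1) by blast
  define Y where "Y = X(Suc d := S)"
  have old: "Y i = X i" if "i \<le> d" for i using that by (simp add: Y_def)
  have new: "Y (Suc d) = S" by (simp add: Y_def)
  have "\<forall>i\<le>Suc d. Y i \<subseteq> V" using sub S by (fastforce simp: le_Suc_eq old new)
  moreover have "disjoint_family_on Y {..Suc d}"
    using disj sub by (fastforce simp: disjoint_family_on_def le_Suc_eq old new)
  moreover have "\<forall>i\<in>{1..Suc d}. Y i \<noteq> {}"
    using ne S by (auto simp: le_Suc_eq old new)
  moreover have "Y 0 \<union> (\<Union>i\<in>I. Y i) \<in> F" if I: "I \<subseteq> {1..Suc d}" for I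
  proof -
    let ?J = "I - {Suc d}"
    have J: "?J \<subseteq> {1..d}" using I by (force simp: le_Suc_eq)
    then have "(\<Union>i\<in>?J. Y i) = (\<Union>i\<in>?J. X i)" using old by (intro SUP_cong) auto
    then have "Y 0 \<union> (\<Union>i\<in>I. Y i)
        = (if Suc d \<in> I then X 0 \<union> (\<Union>i\<in>?J. X i) \<union> S else X 0 \<union> (\<Union>i\<in>?J. X i))"
      using old[of 0] new by (auto split: if_splits)
    then show ?thesis using mem[OF J] by (auto simp: difference_family_def)
  qed
  ultimately show ?case by blast
qed

theorem theorem2:
  fixes n d :: nat and F :: "nat set set"
  assumes "1 \<le> d" and "d \<le> n"
    and "F \<subseteq> Pow {1..n}"
    and "lubell n F > alpha d n"
  shows "contains_boolean_algebra n d F"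
proof -
  have "F \<inter> Pow {1..n} = F" using assms(3) by auto
  then have "lubell n F = chain_sum F (\<lambda>_. 1) {1..n}"
    by (simp add: lubell_def chain_sum_def)
  then obtain X where X: "\<forall>i\<le>d. X i \<subseteq> {1..n}" "disjoint_family_on X {..d}"
    "\<forall>i\<in>{1..d}. X i \<noteq> {}" "\<forall>I\<subseteq>{1..d}. X 0 \<union> (\<Union>i\<in>I. X i) \<in> F"
    using ex_cube_if_chain_sum_gt_alpha[of "{1..n}" d F] assms(4) by auto
  let ?B = "{X 0 \<union> (\<Union>i\<in>I. X i) | I. I \<subseteq> {1..d}}"
  have "boolean_algebra_dim n d ?B"
    unfolding boolean_algebra_dim_def
    using X(1-3) by (intro exI[of _ X]) (auto simp: atLeast0AtMost)
  moreover have "?B \<subseteq> F" using X(4) by blast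
  ultimately show ?thesis unfolding contains_boolean_algebra_def by blast
qed

end
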